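(* Let $V$ be a finite-dimensional vector space over a field $K$, let $\mathcal{A}$ be a linear subspace of $\operatorname{End}(V)$, set $r := \operatorname{rk}\mathcal{A}$, and suppose that $|K| > r$. Set $\mathcal{A}_{\mathrm{reg}} := \{A \in \mathcal{A} \mid \operatorname{rk} A = r\}$ and define the space \[ \mathrm{RND}(\mathcal{A}) := \{B \in \operatorname{End}(V) \mid B \ker A \subseteq \operatorname{im} A \text{ for all } A \in \mathcal{A}_{\mathrm{reg}}\}. \] Then $\mathrm{RND}(\mathcal{A}) \supseteq \mathcal{A}$, and if equality holds, then $\mathcal{A}$ is rank-critical. If, moreover, a group $G$ acts linearly on $V$ and $\mathcal{A}$ is stable under the conjugation action of $G$ on $\operatorname{End}(V)$, then $\mathrm{RND}(\mathcal{A})$ is also $G$-stable.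
   Context: $\operatorname{End}(V)$ is the space of $K$-linear maps $V\to V$. The (generic) rank $\operatorname{rk} \mathcal{A}$ of a linear subspace $\mathcal{A}\subseteq\operatorname{End}(V)$ is the highest rank of an element of $\mathcal{A}$. The space $\mathcal{A}$ is called rank-critical if every linear subspace $\mathcal{B}$ of $\operatorname{End}(V)$ that properly contains $\mathcal{A}$ satisfies $\operatorname{rk} \mathcal{B} > \operatorname{rk} \mathcal{A}$. If $G$ acts linearly on $V$ via $\rho: G \to \mathrm{GL}(V)$, the conjugation action on $\operatorname{End}(V)$ is $gA := \rho(g) A \rho(g)^{-1}$. *)

theory Defs
  imports Complex_Main "HOL-Library.Function_Algebras" "HOL-Algebra.Group"
begin

text \<open>
  A vector space over the field \<open>'k\<close> is given by its scalar multiplication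
  \<open>scale :: 'k \<Rightarrow> 'v \<Rightarrow> 'v\<close>, its underlying set being the type \<open>'v\<close>. Endomorphisms are
  functions \<open>'v \<Rightarrow> 'v\<close>; sums of them and the zero map are those of
  \<^theory>\<open>HOL-Library.Function_Algebras\<close>.
\<close>

definition endos :: "('k::field \<Rightarrow> 'v::ab_group_add \<Rightarrow> 'v) \<Rightarrow> ('v \<Rightarrow> 'v) set"
  where "endos scale = {A. Vector_Spaces.linear scale scale A}"

definition fun_scale :: "('k \<Rightarrow> 'v \<Rightarrow> 'v) \<Rightarrow> 'k \<Rightarrow> ('v \<Rightarrow> 'v) \<Rightarrow> 'v \<Rightarrow> 'v"
  where "fun_scale scale c A = (\<lambda>v. scale c (A v))"

definition endo_subspace :: "('k::field \<Rightarrow> 'v::ab_group_add \<Rightarrow> 'v) \<Rightarrow> ('v \<Rightarrow> 'v) set \<Rightarrow> bool"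
  where "endo_subspace scale \<A> \<longleftrightarrow>
    \<A> \<subseteq> endos scale \<and> module.subspace (fun_scale scale) \<A>"

definition rk :: "('k::field \<Rightarrow> 'v::ab_group_add \<Rightarrow> 'v) \<Rightarrow> ('v \<Rightarrow> 'v) \<Rightarrow> nat"
  where "rk scale A = vector_space.dim scale (range A)"

definition ker :: "('v \<Rightarrow> 'v::zero) \<Rightarrow> 'v set"
  where "ker A = {v. A v = 0}"

text \<open>
  The maximum is over a finite set when the vector space is finite-dimensional; see
  \<open>finite_rk_image\<close> below.
\<close>

definition generic_rk :: "('k::field \<Rightarrow> 'v::ab_group_add \<Rightarrow> 'v) \<Rightarrow> ('v \<Rightarrow> 'v) set \<Rightarrow> nat"
  where "generic_rk scale \<A> = Max (rk scale ` \<A>)"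

definition rank_critical :: "('k::field \<Rightarrow> 'v::ab_group_add \<Rightarrow> 'v) \<Rightarrow> ('v \<Rightarrow> 'v) set \<Rightarrow> bool"
  where "rank_critical scale \<A> \<longleftrightarrow>
    (\<forall>\<B>. endo_subspace scale \<B> \<longrightarrow> \<A> \<subset> \<B> \<longrightarrow> generic_rk scale \<A> < generic_rk scale \<B>)"

definition reg :: "('k::field \<Rightarrow> 'v::ab_group_add \<Rightarrow> 'v) \<Rightarrow> ('v \<Rightarrow> 'v) set \<Rightarrow> ('v \<Rightarrow> 'v) set"
  where "reg scale \<A> = {A \<in> \<A>. rk scale A = generic_rk scale \<A>}"

definition RND :: "('k::field \<Rightarrow> 'v::ab_group_add \<Rightarrow> 'v) \<Rightarrow> ('v \<Rightarrow> 'v) set \<Rightarrow> ('v \<Rightarrow> 'v) set"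
  where "RND scale \<A> = {B \<in> endos scale. \<forall>A \<in> reg scale \<A>. B ` ker A \<subseteq> range A}"

definition GL :: "('k::field \<Rightarrow> 'v::ab_group_add \<Rightarrow> 'v) \<Rightarrow> ('v \<Rightarrow> 'v) monoid"
  where "GL scale = \<lparr>carrier = {f \<in> endos scale. bij f}, mult = (\<circ>), one = id\<rparr>"

definition linear_action ::
  "('k::field \<Rightarrow> 'v::ab_group_add \<Rightarrow> 'v) \<Rightarrow> ('g, 'm) monoid_scheme \<Rightarrow> ('g \<Rightarrow> 'v \<Rightarrow> 'v) \<Rightarrow> bool"
  where "linear_action scale G \<rho> \<longleftrightarrow> group G \<and> \<rho> \<in> hom G (GL scale)"

definition conj_action :: "('g \<Rightarrow> 'v \<Rightarrow> 'v) \<Rightarrow> 'g \<Rightarrow> ('v \<Rightarrow> 'v) \<Rightarrow> 'v \<Rightarrow> 'v"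
  where "conj_action \<rho> g A = \<rho> g \<circ> A \<circ> inv_into UNIV (\<rho> g)"

definition conj_stable ::
  "('g, 'm) monoid_scheme \<Rightarrow> ('g \<Rightarrow> 'v \<Rightarrow> 'v) \<Rightarrow> ('v \<Rightarrow> 'v) set \<Rightarrow> bool"
  where "conj_stable G \<rho> \<A> \<longleftrightarrow> (\<forall>g \<in> carrier G. \<forall>A \<in> \<A>. conj_action \<rho> g A \<in> \<A>)"

text \<open>
  \<^const>\<open>module.subspace\<close> and \<^const>\<open>vector_space.dim\<close> have their intended meaning only in a
  module or vector space; the next lemma is what justifies using the former in
  \<^const>\<open>endo_subspace\<close>.
\<close>

lemma vector_space_fun_scale:
  assumes "vector_space scale"
  shows "vector_space (fun_scale scale)"
proof -
  interpret vector_space scale by fact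
  show ?thesis
    by unfold_locales
      (simp_all add: fun_scale_def fun_eq_iff scale_right_distrib scale_left_distrib)
qed

lemma endo_subspace_iff:
  assumes "vector_space scale"
  shows "endo_subspace scale \<A> \<longleftrightarrow> \<A> \<subseteq> endos scale \<and> (\<lambda>v. 0) \<in> \<A> \<and>
    (\<forall>A\<in>\<A>. \<forall>B\<in>\<A>. (\<lambda>v. A v + B v) \<in> \<A>) \<and> (\<forall>c. \<forall>A\<in>\<A>. (\<lambda>v. scale c (A v)) \<in> \<A>)"
proof -
  interpret E: vector_space "fun_scale scale" using vector_space_fun_scale[OF assms] .
  show ?thesis
    by (simp add: endo_subspace_def E.subspace_def plus_fun_def zero_fun_def fun_scale_def)
qed

lemma finite_rk_image:
  assumes "finite_dimensional_vector_space scale Basis"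
  shows "finite (rk scale ` \<A>)"
proof -
  interpret finite_dimensional_vector_space scale Basis by fact
  have "rk scale ` \<A> \<subseteq> {..dimension}"
    using dim_subset_UNIV by (auto simp: rk_def)
  then show ?thesis by (rule finite_subset) simp
qed

lemma group_GL:
  assumes "vector_space scale"
  shows "group (GL scale)"
proof -
  interpret vector_space scale by fact
  interpret p: vector_space_pair scale scale ..
  show ?thesis
  proof (rule groupI)
    fix f assume f: "f \<in> carrier (GL scale)"
    then interpret f: Vector_Spaces.linear scale scale f by (simp add: GL_def endos_def)
    have b: "bij f" using f by (simp add: GL_def)
    have "Vector_Spaces.linear scale scale (inv_into UNIV f)"
      by (unfold_locales)
        (metis b bij_inv_eq_iff f.add, metis b bij_inv_eq_iff f.scale)
    then show "\<exists>h\<in>carrier (GL scale). h \<otimes>\<^bsub>GL scale\<^esub> f = \<one>\<^bsub>GL scale\<^esub>"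
      using b by (intro bexI[of _ "inv_into UNIV f"])
        (auto simp: GL_def endos_def bij_imp_bij_inv inj_iff[symmetric] bij_is_inj)
  qed (auto simp: GL_def endos_def linear_id linear_compose bij_comp o_assoc
      intro: Vector_Spaces.linear_compose)
qed

lemma endo_subspace_RND:
  assumes "vector_space scale" "\<A> \<subseteq> endos scale"
  shows "endo_subspace scale (RND scale \<A>)"
proof -
  interpret vector_space scale by fact
  interpret p: vector_space_pair scale scale ..
  have im: "subspace (range A)" if "A \<in> reg scale \<A>" for A
  proof -
    interpret A: Vector_Spaces.linear scale scale A
      using that assms(2) by (auto simp: reg_def endos_def)
    show ?thesis by (intro A.subspace_image subspace_UNIV)
  qed
  show ?thesis
    unfolding endo_subspace_iff[OF assms(1)]
    by (auto simp: RND_def endos_def image_subset_iff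
        intro: p.linear_zero p.linear_compose_add p.linear_compose_scale_right
          subspace_0[OF im] subspace_add[OF im] subspace_scale[OF im])
qed

end

theory Submission
  imports Defs
begin

text \<open>
  If \<open>A\<close> has rank \<open>r\<close> and \<open>B\<close> maps some \<open>w \<in> ker A\<close> outside \<open>im A\<close>, let \<open>\<tau>\<close> be a linear left
  inverse of \<open>A\<close> on a complement \<open>U\<close> of \<open>ker A\<close> such that \<open>\<tau> (B w) = 0\<close>. If \<open>B + cA\<close> has rank at
  most \<open>r\<close>, it annihilates some nonzero \<open>u + k w\<close> with \<open>u \<in> U\<close>; applying \<open>\<tau>\<close> shows that \<open>u\<close> is an
  eigenvector of \<open>\<tau> \<circ> B\<close> for the eigenvalue \<open>- c\<close>. If this happened for all \<open>c\<close>, then \<open>U\<close>, of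
  dimension \<open>r\<close>, would contain eigenvectors for \<open>|K| > r\<close> distinct eigenvalues. Using \<open>B + cA\<close>
  rather than \<open>A + cB\<close> includes \<open>B\<close> itself, which is why \<open>|K| > r\<close> suffices.
\<close>

context finite_dimensional_vector_space
begin

text \<open>If \<open>a\<close> were a combination of \<open>S\<close> with coefficients
  \<open>c v\<close>, applying \<open>N\<close> and subtracting \<open>ev a\<close> times the
  relation leaves coefficients \<open>c v * (ev v - ev a)\<close>. Independence of \<open>S\<close>
  and distinctness of the eigenvalues force every \<open>c v\<close> to vanish, so
  \<open>a = 0\<close>.\<close>

lemma independent_eigenvectors:
  assumes N: "Vector_Spaces.linear scale scale N"
    and "finite E" "inj_on ev E" "\<And>x. x \<in> E \<Longrightarrow> x \<noteq> 0 \<and> N x = scale (ev x) x"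
  shows "independent E"
  using assms(2-)
proof (induction E rule: finite_induct)
  case empty
  show ?case by (simp add: independent_empty)
next
  case (insert a S)
  interpret N: Vector_Spaces.linear scale scale N by (fact N)
  have indep: "independent S" using insert by simp
  have "a \<notin> span S"
  proof
    assume "a \<in> span S"
    then obtain c where c: "a = (\<Sum>v\<in>S. scale (c v) v)"
      using insert.hyps(1) by (auto simp: span_finite)
    have "scale (ev a) a = N a" using insert.prems by simp
    also have "\<dots> = (\<Sum>v\<in>S. scale (c v * ev v) v)"
      unfolding c using insert.prems by (simp add: N.sum N.scale)
    finally have "(\<Sum>v\<in>S. scale (c v * ev v - ev a * c v) v) = 0"
      by (subst (asm) (2) c)
        (simp add: scale_left_diff_distrib sum_subtractf scale_sum_right)
    then have z: "c v * ev v - ev a * c v = 0" if "v \<in> S" for v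
      using independentD[OF indep insert.hyps(1) subset_refl, of "\<lambda>v. c v * ev v - ev a * c v"]
        that by blast
    have "c v = 0" if "v \<in> S" for v
    proof -
      have "ev v \<noteq> ev a" using insert.prems(1) insert.hyps(2) that by (metis inj_onD insertCI)
      moreover have "c v * (ev v - ev a) = 0" using z[OF that] by (simp add: algebra_simps)
      ultimately show ?thesis by simp
    qed
    then have "a = 0" by (subst c) simp
    with insert.prems(2) show False by auto
  qed
  with indep show ?case by (simp add: independent_insertI)
qed

text \<open>The rank bound is asked only of the maps \<open>B + cA\<close>, so the lemma applies in
  any space containing \<open>A\<close> and \<open>B\<close>. The infinite case of
  \<open>card\<close> is separate because an infinite type has cardinality 0 in HOL.\<close>

lemma image_ker_subset_range:
  assumes A: "Vector_Spaces.linear scale scale A"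
    and B: "Vector_Spaces.linear scale scale B"
    and card: "infinite (UNIV :: 'a set) \<or> rk scale A < card (UNIV :: 'a set)"
    and rk_le: "\<And>c. rk scale (\<lambda>v. B v + scale c (A v)) \<le> rk scale A"
  shows "B ` ker A \<subseteq> range A"
proof (rule ccontr)
  interpret p: vector_space_pair scale scale ..
  interpret fp: finite_dimensional_vector_space_pair_1 scale Basis scale ..
  interpret A: Vector_Spaces.linear scale scale A by fact
  interpret B: Vector_Spaces.linear scale scale B by fact
  assume "\<not> B ` ker A \<subseteq> range A"
  then obtain w where w: "A w = 0" "B w \<notin> range A"
    by (auto simp: ker_def)
  have sub: "subspace (range A)" by (intro A.subspace_image subspace_UNIV)
  have Bw: "B w \<noteq> 0" using w(2) subspace_0[OF sub] by auto
  obtain C where C: "C \<subseteq> range A" "independent C" "range A \<subseteq> span C" "card C = rk scale A"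
    unfolding rk_def using basis_exists[of "range A"] by blast
  have span_C: "span C = range A" using C(1,3) sub by (simp add: span_minimal subset_antisym)
  have fin_C: "finite C" using C(2) by (rule finiteI_independent)
  \<comment> \<open>Only the values on the basis \<open>C\<close> of the image matter: they are
    preimages spanning the complement of \<open>ker A\<close>.\<close>
  define h where "h = inv_into UNIV A"
  have Ah: "A (h y) = y" if "y \<in> C" for y
    using C(1) that unfolding h_def by (auto intro: f_inv_into_f)
  have Ah_image: "A ` h ` C = C" using Ah by (force simp: image_iff)
  have inj_h: "inj_on h C" using Ah by (metis inj_onI)
  have "inj_on A (h ` C)" using Ah by (auto intro!: inj_onI)
  have indep_h: "independent (h ` C)"
  proof
    assume "dependent (h ` C)"
    then obtain a where a: "a \<in> h ` C" "a \<in> span (h ` C - {a})" by (auto simp: dependent_def)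
    have "A a \<in> span (A ` (h ` C - {a}))"
      using a(2) A.span_image[of "h ` C - {a}"] by blast
    also have "A ` (h ` C - {a}) = C - {A a}"
      using \<open>inj_on A (h ` C)\<close> a(1) Ah_image by (subst inj_on_image_set_diff[where C="h ` C"]) auto
    finally show False using C(2) a(1) Ah_image unfolding dependent_def by blast
  qed
  \<comment> \<open>\<open>A\<close> is injective on this span but kills \<open>w\<close>, and
    \<open>w\<close> is nonzero because \<open>B w\<close> is.\<close>
  have "w \<notin> span (h ` C)"
  proof
    assume wh: "w \<in> span (h ` C)"
    have "inj_on A (span (h ` C))"
      using C(2) Ah_image \<open>inj_on A (h ` C)\<close> by (simp add: A.inj_on_span_iff_independent_image)
    then have "w = 0" by (rule inj_onD) (simp_all add: w(1) wh span_zero A.zero)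
    then show False using Bw B.zero by simp
  qed
  define S where "S = insert w (h ` C)"
  have indep_S: "independent S"
    unfolding S_def using \<open>w \<notin> span (h ` C)\<close> indep_h by (rule independent_insertI)
  have "w \<notin> h ` C" using \<open>w \<notin> span (h ` C)\<close> span_base by blast
  then have dim_S: "dim S = Suc (rk scale A)"
    using indep_S fin_C by (simp add: dim_eq_card_independent S_def card_image[OF inj_h] C(4))
  \<comment> \<open>Since \<open>B w\<close> lies outside \<open>span C\<close>, the value of
    \<open>\<tau>\<close> at \<open>B w\<close> can be chosen independently of its values on
    \<open>C\<close>.\<close>
  have "independent (insert (B w) C)"
    using w(2) C(2) span_C by (simp add: independent_insertI)
  from p.linear_independent_extend[OF this, of "\<lambda>y. if y = B w then 0 else h y"]
  obtain \<tau> where \<tau>: "Vector_Spaces.linear scale scale \<tau>" "\<tau> (B w) = 0"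
      "\<And>y. y \<in> C \<Longrightarrow> \<tau> y = h y"
    using w(2) C(1) by (metis insertCI subsetD)
  interpret \<tau>: Vector_Spaces.linear scale scale \<tau> by fact
  have \<tau>A: "\<tau> (A u) = u" if "u \<in> span (h ` C)" for u
  proof -
    have "(\<tau> \<circ> A) u = id u"
      by (rule p.linear_eq_on[OF Vector_Spaces.linear_compose[OF A \<tau>(1)] linear_id that])
        (auto simp: Ah \<tau>(3))
    then show ?thesis by simp
  qed
  have "\<exists>u. u \<in> span (h ` C) \<and> u \<noteq> 0 \<and> \<tau> (B u) = scale (- c) u" for c
  proof -
    define F where "F = (\<lambda>v. B v + scale c (A v))"
    have F: "Vector_Spaces.linear scale scale F"
      unfolding F_def by (intro p.linear_compose_add p.linear_compose_scale_right A B)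
    \<comment> \<open>\<open>S\<close> has one element more than the rank that \<open>F\<close> may
      reach.\<close>
    have "\<not> inj_on F (span S)"
    proof
      assume "inj_on F (span S)"
      then have "dim (F ` S) = dim S" by (rule fp.dim_image_eq[OF F])
      moreover have "dim (F ` S) \<le> dim (range F)" by (intro dim_subset) auto
      ultimately show False using rk_le[of c] dim_S by (simp add: rk_def F_def)
    qed
    then obtain x where x: "x \<in> span S" "F x = 0" "x \<noteq> 0"
      using p.linear_inj_on_iff_eq_0[OF F subspace_span, of S] by blast
    then obtain k where k: "x - scale k w \<in> span (h ` C)"
      by (auto simp: S_def span_breakdown_eq)
    define u where "u = x - scale k w"
    have x_eq: "x = u + scale k w" by (simp add: u_def)
    have "B u + scale k (B w) + scale c (A u) = 0"
      using x(2) by (simp add: F_def x_eq A.add A.scale B.add B.scale w(1))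
    \<comment> \<open>\<open>\<tau>\<close> removes the \<open>B w\<close> term and turns
      \<open>A u\<close> back into \<open>u\<close>.\<close>
    then have "\<tau> (B u + scale k (B w) + scale c (A u)) = 0" by (simp add: \<tau>.zero)
    then have "\<tau> (B u) + scale c u = 0"
      using k by (simp add: \<tau>.add \<tau>.scale \<tau>(2) \<tau>A u_def)
    then have eig: "\<tau> (B u) = scale (- c) u" by (simp add: eq_neg_iff_add_eq_0)
    \<comment> \<open>Otherwise \<open>x\<close> is the multiple \<open>k\<close> of
      \<open>w\<close>, and \<open>F x = 0\<close> forces \<open>k = 0\<close> because
      \<open>B w\<close> is nonzero.\<close>
    have "u \<noteq> 0"
    proof
      assume "u = 0"
      then have "scale k (B w) = 0" using x(2) by (simp add: F_def x_eq A.scale B.scale w(1))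
      then show False using Bw x(3) x_eq \<open>u = 0\<close> by simp
    qed
    with k eig show ?thesis unfolding u_def by blast
  qed
  then obtain e where e: "\<And>c. e c \<in> span (h ` C)" "\<And>c. e c \<noteq> 0"
      "\<And>c. \<tau> (B (e c)) = scale (- c) (e c)"
    by metis
  have inj_e: "inj e"
  proof (rule injI)
    fix c d assume "e c = e d"
    then have "scale (- c) (e c) = scale (- d) (e c)" by (metis e(3))
    then show "c = d" using e(2)[of c] by simp
  qed
  obtain L :: "'a set" where L: "finite L" "card L = Suc (rk scale A)"
  proof (cases "finite (UNIV :: 'a set)")
    case True
    with card have "Suc (rk scale A) \<le> card (UNIV :: 'a set)" by simp
    from obtain_subset_with_card_n[OF this] show ?thesis using that by metis
  next
    case False
    from infinite_arbitrarily_large[OF this] show ?thesis using that by metis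
  qed
  have "independent (e ` L)"
  proof (rule independent_eigenvectors[OF Vector_Spaces.linear_compose[OF B \<tau>(1)]])
    \<comment> \<open>The eigenvalue of \<open>e c\<close> is \<open>- c\<close>, recovered from the
      vector by inverting \<open>e\<close>.\<close>
    show "inj_on (\<lambda>x. - inv_into UNIV e x) (e ` L)"
      using inj_e by (auto simp: inj_on_def)
  qed (use L(1) e inj_e in auto)
  \<comment> \<open>This puts r + 1 independent vectors into the span of r vectors.\<close>
  then have "card (e ` L) \<le> card (h ` C)"
    using e(1) fin_C by (intro independent_span_bound[THEN conjunct2]) auto
  then show False
    using L(2) C(4) by (simp add: card_image[OF inj_on_subset[OF inj_e subset_UNIV]] card_image[OF inj_h])
qed

lemma rk_le_generic_rk:
  "A \<in> \<A> \<Longrightarrow> rk scale A \<le> generic_rk scale \<A>"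
  unfolding generic_rk_def
  by (intro Max_ge finite_rk_image[OF finite_dimensional_vector_space_axioms]) auto

text \<open>For regular \<open>A\<close> every \<open>B + cA\<close> lies in \<B>, so its rank is at
  most that of \<open>A\<close>. This serves both claims: \<B> = \<A> gives the inclusion, and the
  contrapositive gives rank-criticality.\<close>

lemma mem_RND_of_generic_rk_le:
  assumes "endo_subspace scale \<B>" "\<A> \<subseteq> \<B>" "B \<in> \<B>"
    and "generic_rk scale \<B> \<le> generic_rk scale \<A>"
    and "infinite (UNIV :: 'a set) \<or> generic_rk scale \<A> < card (UNIV :: 'a set)"
  shows "B \<in> RND scale \<A>"
proof -
  note \<B> = assms(1)[unfolded endo_subspace_iff[OF vector_space_axioms]]
  have lin: "B \<in> endos scale" if "B \<in> \<B>" for B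
    using \<B> that by auto
  have plus: "(\<lambda>v. A v + B v) \<in> \<B>" if "A \<in> \<B>" "B \<in> \<B>" for A B
    using \<B> that by simp
  have scaled: "(\<lambda>v. scale c (A v)) \<in> \<B>" if "A \<in> \<B>" for c A
    using \<B> that by simp
  have "B ` ker A \<subseteq> range A" if A: "A \<in> reg scale \<A>" for A
  proof (rule image_ker_subset_range)
    have A': "A \<in> \<B>" "rk scale A = generic_rk scale \<A>" using A assms(2) by (auto simp: reg_def)
    show "Vector_Spaces.linear scale scale A" "Vector_Spaces.linear scale scale B"
      using lin[OF A'(1)] lin[OF assms(3)] by (simp_all add: endos_def)
    show "infinite (UNIV :: 'a set) \<or> rk scale A < card (UNIV :: 'a set)"
      using assms(5) A'(2) by simp
    show "rk scale (\<lambda>v. B v + scale c (A v)) \<le> rk scale A" for c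
    proof -
      have "rk scale (\<lambda>v. B v + scale c (A v)) \<le> generic_rk scale \<B>"
        by (intro rk_le_generic_rk plus[OF assms(3)] scaled A'(1))
      then show ?thesis using assms(4) A'(2) by simp
    qed
  qed
  then show ?thesis using lin[OF assms(3)] by (simp add: RND_def)
qed

lemma rk_conj:
  assumes "Vector_Spaces.linear scale scale f" "bij f"
  shows "rk scale (f \<circ> A \<circ> inv_into UNIV f) = rk scale A"
proof -
  interpret fp: finite_dimensional_vector_space_pair_1 scale Basis scale ..
  have "range (f \<circ> A \<circ> inv_into UNIV f) = f ` range A"
    using bij_is_surj[OF bij_imp_bij_inv[OF assms(2)]] by (metis image_comp)
  then show ?thesis
    unfolding rk_def using fp.dim_image_eq[OF assms(1)] bij_is_inj[OF assms(2)]
    by (metis inj_on_subset subset_UNIV)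
qed

text \<open>Conjugation by the inverse of \<open>g\<close> preserves rank, so it maps regular
  elements to regular ones; the condition on \<open>B\<close> at the conjugate of \<open>A\<close>,
  transported by \<open>\<rho> g\<close>, is the condition on the conjugate of \<open>B\<close> at
  \<open>A\<close>.\<close>

lemma conj_stable_RND:
  assumes act: "linear_action scale G \<rho>" and stable: "conj_stable G \<rho> \<A>"
  shows "conj_stable G \<rho> (RND scale \<A>)"
  unfolding conj_stable_def
proof (intro ballI)
  fix g B assume g: "g \<in> carrier G" and B: "B \<in> RND scale \<A>"
  interpret G: group G using act by (simp add: linear_action_def)
  interpret group_hom G "GL scale" \<rho>
    using act group_GL[OF vector_space_axioms]
    by (simp add: linear_action_def group_hom_def group_hom_axioms_def G.group_axioms)
  define f where "f = \<rho> g"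
  \<comment> \<open>The inverse is taken in \<open>G\<close> because stability of \<A> is stated for
    group elements; \<open>inv_f\<close> identifies it with the inverse map.\<close>
  define f' where "f' = \<rho> (inv\<^bsub>G\<^esub> g)"
  have lin: "Vector_Spaces.linear scale scale f" "Vector_Spaces.linear scale scale f'"
    and bij: "bij f" "bij f'"
    using hom_closed[OF g] hom_closed[OF G.inv_closed[OF g]]
    by (auto simp: f_def f'_def GL_def endos_def)
  have "f \<circ> f' = id"
    using hom_mult[OF g G.inv_closed[OF g]] hom_one g by (simp add: f_def f'_def GL_def)
  then have inv_f: "inv_into UNIV f = f'"
    using bij(1) by (intro inv_unique_comp) (use hom_mult[OF G.inv_closed[OF g] g] hom_one g in
      \<open>simp_all add: f_def f'_def GL_def\<close>)
  then have inv_f': "inv_into UNIV f' = f" using inv_inv_eq[OF bij(1)] by simp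
  have ff': "f (f' x) = x" "f' (f x) = x" for x
    using bij(1) unfolding inv_f[symmetric]
    by (simp_all add: bij_is_surj surj_f_inv_f bij_is_inj)
  have "(f \<circ> B \<circ> f') ` ker A \<subseteq> range A" if A: "A \<in> reg scale \<A>" for A
  proof -
    have "conj_action \<rho> (inv\<^bsub>G\<^esub> g) A \<in> \<A>"
      using stable A G.inv_closed[OF g] by (auto simp: conj_stable_def reg_def)
    then have "f' \<circ> A \<circ> f \<in> \<A>"
      by (simp add: conj_action_def inv_f' f'_def[symmetric])
    then have "f' \<circ> A \<circ> f \<in> reg scale \<A>"
      using A rk_conj[OF lin(2) bij(2), of A] by (simp add: reg_def inv_f')
    then have *: "B ` ker (f' \<circ> A \<circ> f) \<subseteq> range (f' \<circ> A \<circ> f)"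
      using B unfolding RND_def by blast
    have "f (B (f' x)) \<in> range A" if "A x = 0" for x
    proof -
      have "f' 0 = 0"
        using lin(2) by (simp add: module_hom_iff_linear[symmetric] module_hom.zero)
      then have "f' x \<in> ker (f' \<circ> A \<circ> f)" using that by (simp add: ker_def ff')
      then obtain y where "B (f' x) = f' (A (f y))" using * by auto
      then show ?thesis by (simp add: ff')
    qed
    then show ?thesis by (auto simp: ker_def)
  qed
  moreover have "f \<circ> B \<circ> f' \<in> endos scale"
    using B lin by (auto simp: RND_def endos_def intro!: Vector_Spaces.linear_compose)
  ultimately show "conj_action \<rho> g B \<in> RND scale \<A>"
    by (simp add: RND_def conj_action_def f_def[symmetric] inv_f)
qed

end

theorem proposition3:
  fixes scale :: "'k::field \<Rightarrow> 'v::ab_group_add \<Rightarrow> 'v"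
    and Basis :: "'v set"
    and \<A> :: "('v \<Rightarrow> 'v) set"
  assumes "finite_dimensional_vector_space scale Basis"
    and "endo_subspace scale \<A>"
    and "infinite (UNIV :: 'k set) \<or> card (UNIV :: 'k set) > generic_rk scale \<A>"
  shows "\<A> \<subseteq> RND scale \<A> \<and>
    (RND scale \<A> = \<A> \<longrightarrow> rank_critical scale \<A>) \<and>
    (\<forall>(G :: ('g, 'm) monoid_scheme) \<rho>.
      linear_action scale G \<rho> \<longrightarrow> conj_stable G \<rho> \<A> \<longrightarrow> conj_stable G \<rho> (RND scale \<A>))"
proof -
  interpret finite_dimensional_vector_space scale Basis by fact
  have "\<A> \<subseteq> RND scale \<A>"
    using mem_RND_of_generic_rk_le[OF assms(2) subset_refl _ order_refl assms(3)] by blast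
  moreover have "rank_critical scale \<A>" if "RND scale \<A> = \<A>"
    unfolding rank_critical_def
  proof (intro allI impI)
    fix \<B> assume \<B>: "endo_subspace scale \<B>" "\<A> \<subset> \<B>"
    then obtain B where "B \<in> \<B>" "B \<notin> \<A>" by blast
    \<comment> \<open>Were the generic rank of \<B> no larger, \<open>B\<close> would have to lie in
      \<open>RND scale \<A>\<close>.\<close>
    with that have "B \<notin> RND scale \<A>" by simp
    then show "generic_rk scale \<A> < generic_rk scale \<B>"
      using mem_RND_of_generic_rk_le[OF \<B>(1) _ \<open>B \<in> \<B>\<close> _ assms(3)] \<B>(2)
      by (meson not_le psubset_imp_subset)
  qed
  ultimately show ?thesis using conj_stable_RND by blast
qed

end
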